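(* Let $R$ be a finite commutative ring with identity and $P$ a proper prime ideal of $R$ with $m=|P|\geq 2$. Put $a=m-1$, $A=P\setminus\{0\}=\{u_1,\ldots,u_a\}$ and $B=R\setminus P$. The minimal vertex covers of $\Gamma_P(R)$ are precisely $A$ and $$(A\setminus\{u_i\})\cup B,\qquad 1\leq i\leq a.$$ Equivalently, $\Gamma_P(R)$ has exactly $a+1=m$ minimal vertex covers.
   Context: For a finite commutative ring $R$ with identity and a proper prime ideal $P$, the prime ideal graph $\Gamma_P(R)$ is the simple graph with vertex set $R\setminus\{0\}$ in which two distinct vertices $x,y$ are adjacent if and only if $xy\in P$. A vertex cover is a set of vertices meeting every edge; it is minimal if no proper subset is a vertex cover. *)

theory Defs
  imports "HOL-Algebra.Ideal" "Graph_Theory.Pair_Digraph"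
begin

text \<open>
  A simple graph is represented, as in the Graph-Theory library, by a symmetric loop-free set of
  ordered pairs: an undirected edge between \<open>x\<close> and \<open>y\<close> is the two arcs \<open>(x, y)\<close> and \<open>(y, x)\<close>.
\<close>

definition prime_ideal_graph :: "('a, 'b) ring_scheme \<Rightarrow> 'a set \<Rightarrow> 'a pair_pre_digraph" where
  "prime_ideal_graph R P =
     \<lparr> pverts = carrier R - {\<zero>\<^bsub>R\<^esub>},
       parcs = {(x, y). x \<in> carrier R - {\<zero>\<^bsub>R\<^esub>} \<and> y \<in> carrier R - {\<zero>\<^bsub>R\<^esub>} \<and>
                        x \<noteq> y \<and> x \<otimes>\<^bsub>R\<^esub> y \<in> P} \<rparr>"

lemma pair_graph_prime_ideal_graph:
  assumes "cring R" and "finite (carrier R)"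
  shows "pair_graph (prime_ideal_graph R P)"
proof -
  interpret cring R by fact
  let ?V = "carrier R - {\<zero>\<^bsub>R\<^esub>}"
  have "parcs (prime_ideal_graph R P) \<subseteq> ?V \<times> ?V"
    by (auto simp: prime_ideal_graph_def)
  then have "finite (parcs (prime_ideal_graph R P))"
    using assms(2) by (meson finite_Diff finite_SigmaI finite_subset)
  moreover have "sym (parcs (prime_ideal_graph R P))"
    by (auto simp: prime_ideal_graph_def sym_def m_comm)
  ultimately show ?thesis
    using assms(2) by unfold_locales (auto simp: prime_ideal_graph_def symmetric_def)
qed

definition vertex_cover :: "'a pair_pre_digraph \<Rightarrow> 'a set \<Rightarrow> bool" where
  "vertex_cover G C \<longleftrightarrow> C \<subseteq> pverts G \<and> (\<forall>(x, y) \<in> parcs G. C \<inter> {x, y} \<noteq> {})"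

definition minimal_vertex_cover :: "'a pair_pre_digraph \<Rightarrow> 'a set \<Rightarrow> bool" where
  "minimal_vertex_cover G C \<longleftrightarrow> vertex_cover G C \<and> (\<forall>D. D \<subset> C \<longrightarrow> \<not> vertex_cover G D)"

end

theory Submission
  imports Defs
begin

text \<open>
  Primality of \<open>P\<close> turns the edge relation into a purely combinatorial one: distinct nonzero \<open>x\<close>
  and \<open>y\<close> are adjacent iff one of them lies in \<open>A\<close>. So the graph is a complete split graph, a
  clique \<open>A\<close> joined completely to an independent set \<open>B\<close>. A set is a vertex cover iff its
  complement is independent, and an independent set of such a graph is either contained in \<open>B\<close> or
  is a single vertex of \<open>A\<close>. The maximal independent sets are therefore \<open>B\<close> (which is not
  contained in any \<open>{x}\<close> with \<open>x \<in> A\<close>, since it contains the identity of the ring) and the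
  singletons \<open>{x}\<close> with \<open>x \<in> A\<close>; their complements are the minimal vertex covers. These are
  pairwise distinct because \<open>x\<close> is the only element of \<open>A\<close> missing from \<open>(A - {x}) \<union> B\<close>.
\<close>

definition complete_split_graph :: "'a set \<Rightarrow> 'a set \<Rightarrow> 'a pair_pre_digraph" where
  "complete_split_graph A B =
     \<lparr> pverts = A \<union> B,
       parcs = {(x, y). x \<in> A \<union> B \<and> y \<in> A \<union> B \<and> x \<noteq> y \<and> (x \<in> A \<or> y \<in> A)} \<rparr>"

lemma prime_ideal_graph_eq_complete_split_graph:
  assumes "primeideal P R"
  shows "prime_ideal_graph R P = complete_split_graph (P - {\<zero>\<^bsub>R\<^esub>}) (carrier R - P)"
proof -
  interpret primeideal P R by fact
  have prod: "x \<otimes>\<^bsub>R\<^esub> y \<in> P \<longleftrightarrow> x \<in> P \<or> y \<in> P"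
    if "x \<in> carrier R" "y \<in> carrier R" for x y
    using I_prime[OF that] I_l_closed[OF _ that(1), of y] I_r_closed[OF _ that(2), of x] by argo
  have "\<zero>\<^bsub>R\<^esub> \<in> P"
    by (rule additive_subgroup.zero_closed[OF is_additive_subgroup])
  then have verts: "(P - {\<zero>\<^bsub>R\<^esub>}) \<union> (carrier R - P) = carrier R - {\<zero>\<^bsub>R\<^esub>}"
    using a_subset by auto
  have "x \<otimes>\<^bsub>R\<^esub> y \<in> P \<longleftrightarrow> x \<in> P - {\<zero>\<^bsub>R\<^esub>} \<or> y \<in> P - {\<zero>\<^bsub>R\<^esub>}"
    if "x \<in> carrier R - {\<zero>\<^bsub>R\<^esub>}" "y \<in> carrier R - {\<zero>\<^bsub>R\<^esub>}" for x y
    using prod[of x y] that by simp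
  then show ?thesis
    unfolding prime_ideal_graph_def complete_split_graph_def verts
    by (simp cong: conj_cong)
qed

text \<open>
  Two vertices outside a cover are never adjacent, so a cover that misses some \<open>x \<in> A\<close> misses
  nothing else, as \<open>x\<close> is adjacent to every other vertex.
\<close>

lemma vertex_cover_complete_split_graph_iff:
  assumes "A \<inter> B = {}"
  shows "vertex_cover (complete_split_graph A B) C \<longleftrightarrow>
           C \<subseteq> A \<union> B \<and> (A \<subseteq> C \<or> (\<exists>x\<in>A. C = (A - {x}) \<union> B))"
    (is "?cover \<longleftrightarrow> ?form")
proof
  assume ?cover
  then have sub: "C \<subseteq> A \<union> B"
    by (auto simp: vertex_cover_def complete_split_graph_def)
  have edge: "x \<in> C \<or> y \<in> C" if "x \<in> A" "y \<in> A \<union> B" "x \<noteq> y" for x y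
    using \<open>?cover\<close> that by (auto simp: vertex_cover_def complete_split_graph_def)
  have "C = (A - {x}) \<union> B" if "x \<in> A" "x \<notin> C" for x
  proof
    show "C \<subseteq> (A - {x}) \<union> B"
      using sub that by auto
    show "(A - {x}) \<union> B \<subseteq> C"
      using edge[OF that(1)] that assms by auto
  qed
  then show ?form
    using sub by blast
next
  assume ?form
  then show ?cover
    using assms by (auto simp: vertex_cover_def complete_split_graph_def)
qed

text \<open>
  No two of the candidates are comparable: the only element of \<open>A\<close> missing from \<open>(A - {x}) \<union> B\<close> is
  \<open>x\<close>, and \<open>(A - {x}) \<union> B\<close> is not contained in \<open>A\<close> as \<open>B\<close> is nonempty. For empty \<open>B\<close> the graph
  would be complete, and every \<open>A - {x}\<close> with \<open>x \<in> A\<close> a cover smaller than \<open>A\<close>.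
\<close>

lemma minimal_vertex_cover_complete_split_graph_iff:
  assumes "A \<inter> B = {}" and "B \<noteq> {}"
  shows "minimal_vertex_cover (complete_split_graph A B) C \<longleftrightarrow>
           C = A \<or> (\<exists>x\<in>A. C = (A - {x}) \<union> B)"
    (is "?minimal \<longleftrightarrow> ?form")
proof
  assume min: ?minimal
  show ?form
  proof (cases "A \<subseteq> C")
    case True
    have "vertex_cover (complete_split_graph A B) A"
      using assms(1) by (simp add: vertex_cover_complete_split_graph_iff)
    then have "\<not> A \<subset> C"
      using min by (auto simp only: minimal_vertex_cover_def)
    then show ?thesis
      using True by auto
  next
    case False
    moreover have "vertex_cover (complete_split_graph A B) C"
      using min by (simp add: minimal_vertex_cover_def)
    ultimately show ?thesis
      using assms(1) by (simp add: vertex_cover_complete_split_graph_iff)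
  qed
next
  assume form: ?form
  then have "vertex_cover (complete_split_graph A B) C"
    using assms(1) by (auto simp: vertex_cover_complete_split_graph_iff)
  moreover have "\<not> vertex_cover (complete_split_graph A B) D" if "D \<subset> C" for D
  proof
    assume "vertex_cover (complete_split_graph A B) D"
    then consider "A \<subseteq> D" | y where "y \<in> A" "D = (A - {y}) \<union> B"
      using assms(1) by (auto simp: vertex_cover_complete_split_graph_iff)
    then show False
    proof cases
      case 1
      then show False
        using form that assms(1) by auto
    next
      case 2
      then show False
        using form that assms by auto
    qed
  qed
  ultimately show ?minimal
    by (simp add: minimal_vertex_cover_def)
qed

theorem proposition3p1:
  fixes R :: "('a, 'b) ring_scheme" and P A B :: "'a set"
    and m a :: nat and u :: "nat \<Rightarrow> 'a"
  assumes "cring R" and "finite (carrier R)"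
    and "primeideal P R"
    and "m = card P" and "m \<ge> 2"
    and "a = m - 1"
    and "A = P - {\<zero>\<^bsub>R\<^esub>}" and "B = carrier R - P"
    and "bij_betw u {1..a} A"
  shows "{C. minimal_vertex_cover (prime_ideal_graph R P) C}
           = {A} \<union> {(A - {u i}) \<union> B | i. 1 \<le> i \<and> i \<le> a}
         \<and> card {C. minimal_vertex_cover (prime_ideal_graph R P) C} = a + 1
         \<and> a + 1 = m"
proof -
  interpret primeideal P R by fact
  have disj: "A \<inter> B = {}"
    using assms(7,8) by blast
  have "B \<noteq> {}"
    using I_notcarr a_subset assms(8) by blast
  have range_u: "A = u ` {1..a}" and inj_u: "inj_on u {1..a}"
    using assms(9) by (auto simp: bij_betw_def)
  let ?M = "{C. minimal_vertex_cover (prime_ideal_graph R P) C}"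
  let ?cover = "\<lambda>x. (A - {x}) \<union> B"
  have M: "?M = insert A (?cover ` A)"
    unfolding prime_ideal_graph_eq_complete_split_graph[OF assms(3)] assms(7,8)[symmetric]
      minimal_vertex_cover_complete_split_graph_iff[OF disj \<open>B \<noteq> {}\<close>]
    by blast
  have inj_cover: "inj_on ?cover A"
    using disj by (intro inj_onI) blast
  have A_neq: "A \<notin> ?cover ` A"
    using disj by blast
  have "finite A" and card_A: "card A = a"
    using range_u card_image[OF inj_u] by auto
  then have "card ?M = a + 1"
    unfolding M using A_neq by (simp add: card_image[OF inj_cover])
  moreover have "?cover ` A = {(A - {u i}) \<union> B | i. 1 \<le> i \<and> i \<le> a}"
  proof -
    have "?cover ` A = (\<lambda>i. ?cover (u i)) ` {1..a}"
      by (subst (2) range_u) (simp add: image_image)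
    then show ?thesis
      by auto
  qed
  ultimately show ?thesis
    using M assms(5,6) by simp
qed

end
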